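(* Let $(X,d)$ be an unbounded metric space. Then all pretangent spaces to $(X,d)$ at infinity are complete; that is, for every scaling sequence $\tilde r$ and every maximal self-stable set $\tilde X_{\infty,\tilde r}\subseteq Seq(X,\tilde r)$, the pretangent space $(\Omega_{\infty,\tilde r}^{X},\rho)$ (the metric identification of $(\tilde X_{\infty,\tilde r},\tilde d_{\tilde r})$) is a complete metric space.
   Context: Let $(X,d)$ be an unbounded metric space and fix $p\in X$ (the notions below do not depend on the choice of $p$). A scaling sequence is a sequence $\tilde r=(r_n)_{n\in\mathbb N}$ of positive real numbers with $\lim_{n\to\infty}r_n=\infty$. $Seq(X,\tilde r)$ is the set of all sequences $\tilde x=(x_n)_{n\in\mathbb N}$ in $X$ such that $\lim_{n\to\infty} d(x_n,p)=\infty$ and the limit $\lim_{n\to\infty} d(x_n,p)/r_n$ exists and is finite. Two sequences $\tilde x,\tilde y$ in $X$ are mutually stable (with respect to $\tilde r$) if the limit $\tilde d_{\tilde r}(\tilde x,\tilde y):=\lim_{n\to\infty}d(x_n,y_n)/r_n$ exists and is finite. A set $F\subseteq Seq(X,\tilde r)$ is self-stable if any two of its elements are mutually stable; it is maximal self-stable if it is self-stable and for every $\tilde y\in Seq(X,\tilde r)$ either $\tilde y\in F$ or there is $\tilde x\in F$ such that $\tilde x$ and $\tilde y$ are not mutually stable. Maximal self-stable sets are denoted $\tilde X_{\infty,\tilde r}$. On a maximal self-stable set, $\tilde d_{\tilde r}$ is a pseudometric; the corresponding pretangent space $(\Omega_{\infty,\tilde r}^X,\rho)$ to $(X,d)$ at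 infinity with respect to $\tilde r$ is its metric identification: points are the classes of the equivalence relation $\tilde x\equiv\tilde y\Leftrightarrow\tilde d_{\tilde r}(\tilde x,\tilde y)=0$ on $\tilde X_{\infty,\tilde r}$, and $\rho(\alpha,\beta)=\tilde d_{\tilde r}(\tilde x,\tilde y)$ for $\tilde x\in\alpha$, $\tilde y\in\beta$. *)

theory Defs
  imports "HOL-Analysis.Analysis"
begin

text \<open>
  Throughout, a metric space is a pair \<open>X\<close>, \<open>d\<close> with \<open>Metric_space X d\<close>, where \<open>X\<close> is a
  carrier set and only the values of \<open>d\<close> on \<open>X\<close> matter.
\<close>

definition unbounded_metric_space :: "'a set \<Rightarrow> ('a \<Rightarrow> 'a \<Rightarrow> real) \<Rightarrow> bool" where
  "unbounded_metric_space X d \<longleftrightarrow> Metric_space X d \<and> \<not> Metric_space.mbounded X d X"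

definition scaling_sequence :: "(nat \<Rightarrow> real) \<Rightarrow> bool" where
  "scaling_sequence r \<longleftrightarrow> (\<forall>n. r n > 0) \<and> filterlim r at_top sequentially"

definition Seq_infty ::
    "'a set \<Rightarrow> ('a \<Rightarrow> 'a \<Rightarrow> real) \<Rightarrow> 'a \<Rightarrow> (nat \<Rightarrow> real) \<Rightarrow> (nat \<Rightarrow> 'a) set" where
  "Seq_infty X d p r =
     {x. (\<forall>n. x n \<in> X) \<and> filterlim (\<lambda>n. d (x n) p) at_top sequentially
         \<and> convergent (\<lambda>n. d (x n) p / r n)}"

definition mutually_stable ::
    "('a \<Rightarrow> 'a \<Rightarrow> real) \<Rightarrow> (nat \<Rightarrow> real) \<Rightarrow> (nat \<Rightarrow> 'a) \<Rightarrow> (nat \<Rightarrow> 'a) \<Rightarrow> bool" where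
  "mutually_stable d r x y \<longleftrightarrow> convergent (\<lambda>n. d (x n) (y n) / r n)"

text \<open>Meaningful only for mutually stable sequences.\<close>

definition stable_dist ::
    "('a \<Rightarrow> 'a \<Rightarrow> real) \<Rightarrow> (nat \<Rightarrow> real) \<Rightarrow> (nat \<Rightarrow> 'a) \<Rightarrow> (nat \<Rightarrow> 'a) \<Rightarrow> real" where
  "stable_dist d r x y = lim (\<lambda>n. d (x n) (y n) / r n)"

definition self_stable ::
    "'a set \<Rightarrow> ('a \<Rightarrow> 'a \<Rightarrow> real) \<Rightarrow> 'a \<Rightarrow> (nat \<Rightarrow> real) \<Rightarrow> (nat \<Rightarrow> 'a) set \<Rightarrow> bool" where
  "self_stable X d p r F \<longleftrightarrow>
     F \<subseteq> Seq_infty X d p r \<and> (\<forall>x\<in>F. \<forall>y\<in>F. mutually_stable d r x y)"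

definition maximal_self_stable ::
    "'a set \<Rightarrow> ('a \<Rightarrow> 'a \<Rightarrow> real) \<Rightarrow> 'a \<Rightarrow> (nat \<Rightarrow> real) \<Rightarrow> (nat \<Rightarrow> 'a) set \<Rightarrow> bool" where
  "maximal_self_stable X d p r F \<longleftrightarrow>
     self_stable X d p r F \<and>
     (\<forall>y\<in>Seq_infty X d p r. y \<in> F \<or> (\<exists>x\<in>F. \<not> mutually_stable d r x y))"

definition stable_equiv ::
    "('a \<Rightarrow> 'a \<Rightarrow> real) \<Rightarrow> (nat \<Rightarrow> real) \<Rightarrow> (nat \<Rightarrow> 'a) set
      \<Rightarrow> ((nat \<Rightarrow> 'a) \<times> (nat \<Rightarrow> 'a)) set" where
  "stable_equiv d r F = {(x, y). x \<in> F \<and> y \<in> F \<and> stable_dist d r x y = 0}"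

definition pretangent_points ::
    "('a \<Rightarrow> 'a \<Rightarrow> real) \<Rightarrow> (nat \<Rightarrow> real) \<Rightarrow> (nat \<Rightarrow> 'a) set \<Rightarrow> (nat \<Rightarrow> 'a) set set" where
  "pretangent_points d r F = F // stable_equiv d r F"

text \<open>
  The metric on classes, by representatives; \<open>pretangent_dist_eq\<close> below shows that it does not
  depend on their choice.  The value 0 off the carrier is a convention, needed because
  \<open>Metric_space\<close> demands symmetry and nonnegativity on the whole type.
\<close>

definition pretangent_dist ::
    "('a \<Rightarrow> 'a \<Rightarrow> real) \<Rightarrow> (nat \<Rightarrow> real) \<Rightarrow> (nat \<Rightarrow> 'a) set
      \<Rightarrow> (nat \<Rightarrow> 'a) set \<Rightarrow> (nat \<Rightarrow> 'a) set \<Rightarrow> real" where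
  "pretangent_dist d r F \<alpha> \<beta> =
     (if \<alpha> \<in> pretangent_points d r F \<and> \<beta> \<in> pretangent_points d r F
      then THE t. \<exists>x\<in>\<alpha>. \<exists>y\<in>\<beta>. t = stable_dist d r x y
      else 0)"

lemma stable_dist_tendsto:
  assumes "self_stable X d p r F" "x \<in> F" "y \<in> F"
  shows "(\<lambda>n. d (x n) (y n) / r n) \<longlonglongrightarrow> stable_dist d r x y"
  using assms by (simp add: self_stable_def mutually_stable_def stable_dist_def convergent_LIMSEQ_iff)

lemma stable_dist_self:
  assumes "Metric_space X d" "self_stable X d p r F" "x \<in> F"
  shows "stable_dist d r x x = 0"
proof -
  have "x n \<in> X" for n
    using assms by (auto simp: self_stable_def Seq_infty_def)
  then have "d (x n) (x n) = 0" for n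
    using Metric_space.mdist_zero[OF assms(1)] by blast
  then show ?thesis by (simp add: stable_dist_def)
qed

lemma stable_dist_commute:
  assumes "Metric_space X d"
  shows "stable_dist d r x y = stable_dist d r y x"
  by (simp add: stable_dist_def Metric_space.commute[OF assms])

lemma stable_dist_triangle:
  assumes "Metric_space X d" "scaling_sequence r" "self_stable X d p r F"
    and "x \<in> F" "y \<in> F" "z \<in> F"
  shows "stable_dist d r x z \<le> stable_dist d r x y + stable_dist d r y z"
proof (rule LIMSEQ_le)
  show "(\<lambda>n. d (x n) (z n) / r n) \<longlonglongrightarrow> stable_dist d r x z"
    by (intro stable_dist_tendsto[OF assms(3)] assms)
  show "(\<lambda>n. d (x n) (y n) / r n + d (y n) (z n) / r n)
          \<longlonglongrightarrow> stable_dist d r x y + stable_dist d r y z"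
    by (intro tendsto_add stable_dist_tendsto[OF assms(3)] assms)
  have "d (x n) (z n) / r n \<le> d (x n) (y n) / r n + d (y n) (z n) / r n" for n
  proof -
    have "x n \<in> X" "y n \<in> X" "z n \<in> X"
      using assms by (auto simp: self_stable_def Seq_infty_def)
    then have "d (x n) (z n) \<le> d (x n) (y n) + d (y n) (z n)"
      by (rule Metric_space.triangle[OF assms(1)])
    moreover have "r n > 0" using assms(2) by (simp add: scaling_sequence_def)
    ultimately show ?thesis
      by (metis add_divide_distrib divide_right_mono less_imp_le)
  qed
  then show "\<exists>N. \<forall>n\<ge>N. d (x n) (z n) / r n \<le> d (x n) (y n) / r n + d (y n) (z n) / r n"
    by blast
qed

lemma stable_dist_nonneg:
  assumes "Metric_space X d" "scaling_sequence r" "self_stable X d p r F" "x \<in> F" "y \<in> F"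
  shows "stable_dist d r x y \<ge> 0"
  using stable_dist_triangle[OF assms(1-5) assms(4)] stable_dist_self[OF assms(1,3,4)]
    stable_dist_commute[OF assms(1), of r x y] by simp

lemma equiv_stable_equiv:
  assumes "Metric_space X d" "scaling_sequence r" "self_stable X d p r F"
  shows "equiv F (stable_equiv d r F)"
proof (rule equivI)
  show "stable_equiv d r F \<subseteq> F \<times> F" by (auto simp: stable_equiv_def)
  show "refl_on F (stable_equiv d r F)"
    using assms by (auto simp: refl_on_def stable_equiv_def stable_dist_self)
  show "sym (stable_equiv d r F)"
    using stable_dist_commute[OF assms(1)] by (auto simp: sym_def stable_equiv_def)
  show "trans (stable_equiv d r F)"
  proof (rule transI)
    fix x y z
    assume "(x, y) \<in> stable_equiv d r F" "(y, z) \<in> stable_equiv d r F"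
    then show "(x, z) \<in> stable_equiv d r F"
      using stable_dist_triangle[OF assms, of x y z] stable_dist_nonneg[OF assms, of x z]
      by (auto simp: stable_equiv_def)
  qed
qed

lemma pretangent_dist_eq:
  assumes "Metric_space X d" "scaling_sequence r" "self_stable X d p r F"
    and \<alpha>: "\<alpha> \<in> pretangent_points d r F" "x \<in> \<alpha>"
    and \<beta>: "\<beta> \<in> pretangent_points d r F" "y \<in> \<beta>"
  shows "pretangent_dist d r F \<alpha> \<beta> = stable_dist d r x y"
proof -
  note eq = equiv_stable_equiv[OF assms(1-3)]
  have le: "stable_dist d r u v \<le> stable_dist d r u' v'"
    if "u \<in> \<alpha>" "u' \<in> \<alpha>" "v \<in> \<beta>" "v' \<in> \<beta>" for u u' v v'
  proof -
    have "(u, u') \<in> stable_equiv d r F" "(v', v) \<in> stable_equiv d r F"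
      using that \<alpha>(1) \<beta>(1) quotient_eq_iff[OF eq] unfolding pretangent_points_def by blast+
    then show ?thesis
      using stable_dist_triangle[OF assms(1-3), of u u' v]
        stable_dist_triangle[OF assms(1-3), of u' v' v]
      by (auto simp: stable_equiv_def)
  qed
  have "(THE t. \<exists>u\<in>\<alpha>. \<exists>v\<in>\<beta>. t = stable_dist d r u v) = stable_dist d r x y"
    using \<alpha>(2) \<beta>(2) by (intro the_equality) (blast, metis le order_antisym)
  then show ?thesis using \<alpha>(1) \<beta>(1) by (simp add: pretangent_dist_def)
qed

end

theory Submission
  imports Defs
begin

text \<open>
  Represent the members of a Cauchy sequence of points by sequences \<open>x 0, x 1, \<dots>\<close> in \<open>F\<close> and put
  \<open>y n = x (K n) n\<close>, where \<open>K n\<close> tends to infinity so slowly that at time \<open>n\<close> the scaled distances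
  between \<open>x 0, \<dots>, x (K n)\<close> nearly have their limit values and these sequences are already far
  from \<open>p\<close>.  Then \<open>y\<close> is eventually within \<open>\<epsilon>\<close> (after scaling) of every \<open>x i\<close> with \<open>i\<close> large, so
  all scaled distances from \<open>y\<close> to members of \<open>F\<close> converge, being uniformly approximated by
  convergent ones.  Maximality puts \<open>y\<close> into \<open>F\<close>, and its class is the limit.
\<close>

text \<open>Take for \<open>K n\<close> the largest k \<le> n with \<open>P k n\<close>. The bound k
  \<le> n makes the maximum exist, and every fixed k eventually competes for it, so \<open>K\<close>
  tends to infinity. No monotonicity of \<open>P\<close> in k enters.\<close>

lemma slow_diagonal:
  fixes P :: "nat \<Rightarrow> nat \<Rightarrow> bool"
  assumes "\<And>k. eventually (P k) sequentially"
  obtains K where "filterlim K at_top sequentially" "\<forall>\<^sub>F n in sequentially. P (K n) n"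
proof
  define S where "S n = {k. k \<le> n \<and> P k n}" for n
  have fin: "finite (S n)" for n
    by (simp add: S_def)
  show "filterlim (\<lambda>n. Max (S n)) at_top sequentially"
    unfolding filterlim_at_top
  proof
    fix k
    show "\<forall>\<^sub>F n in sequentially. k \<le> Max (S n)"
      using assms[of k] eventually_ge_at_top[of k]
      by eventually_elim (auto intro!: Max_ge fin simp: S_def)
  qed
  show "\<forall>\<^sub>F n in sequentially. P (Max (S n)) n"
    \<comment> \<open>\<open>Max\<close> says nothing on an empty set; once \<open>P 0 n\<close>
      holds, 0 lies in \<open>S n\<close>.\<close>
    using assms[of 0]
  proof eventually_elim
    case (elim n)
    then have "S n \<noteq> {}"
      by (auto simp: S_def)
    from Max_in[OF fin this] show ?case
      by (simp add: S_def)
  qed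
qed

text \<open>The tail oscillation of \<open>a\<close> exceeds that of \<open>b\<close> by at most 2
  \<epsilon>, so \<open>a\<close> is Cauchy and completeness of the reals gives the limit. The
  approximant may change with \<epsilon>.\<close>

lemma convergent_approx:
  fixes a :: "nat \<Rightarrow> real"
  assumes "\<And>\<epsilon>. \<epsilon> > 0 \<Longrightarrow> \<exists>b. convergent b \<and> (\<forall>\<^sub>F n in sequentially. \<bar>a n - b n\<bar> \<le> \<epsilon>)"
  shows "convergent a"
proof -
  have "Cauchy a"
  proof (rule metric_CauchyI)
    fix e :: real
    assume "e > 0"
    \<comment> \<open>Two errors of e / 4 and the oscillation of \<open>b\<close>, strictly below e
      / 2, add up to less than e.\<close>
    then obtain b where b: "convergent b" "\<forall>\<^sub>F n in sequentially. \<bar>a n - b n\<bar> \<le> e / 4"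
      using assms[of "e / 4"] by auto
    from b(2) obtain M where M: "\<And>n. n \<ge> M \<Longrightarrow> \<bar>a n - b n\<bar> \<le> e / 4"
      by (auto simp: eventually_sequentially)
    obtain N where N: "\<And>m n. m \<ge> N \<Longrightarrow> n \<ge> N \<Longrightarrow> dist (b m) (b n) < e / 2"
      using metric_CauchyD[OF convergent_Cauchy[OF b(1)], of "e / 2"] \<open>e > 0\<close> by auto
    show "\<exists>M. \<forall>m\<ge>M. \<forall>n\<ge>M. dist (a m) (a n) < e"
    proof (intro exI allI impI)
      fix m n
      assume "max M N \<le> m" "max M N \<le> n"
      then show "dist (a m) (a n) < e"
        using M[of m] M[of n] N[of m n] by (simp add: dist_real_def abs_if split: if_splits)
    qed
  qed
  then show ?thesis
    by (simp add: Cauchy_convergent_iff)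
qed

text \<open>By the reverse triangle inequality, replacing \<open>y\<close> by \<open>x i\<close>
  changes the scaled distance to \<open>z\<close> by at most that between \<open>y\<close> and
  \<open>x i\<close>. Since \<open>z\<close> may be any sequence in \<open>X\<close>, the constant
  sequence at the base point is covered.\<close>

lemma convergent_scaled_dist:
  assumes "Metric_space X d" "scaling_sequence r"
    and "\<And>i n. x i n \<in> X" "\<And>n. y n \<in> X" "\<And>n. z n \<in> X"
    and conv: "\<And>i. convergent (\<lambda>n. d (x i n) (z n) / r n)"
    and approx: "\<And>\<epsilon>. \<epsilon> > 0 \<Longrightarrow> \<exists>i. \<forall>\<^sub>F n in sequentially. d (y n) (x i n) / r n \<le> \<epsilon>"
  shows "convergent (\<lambda>n. d (y n) (z n) / r n)"
proof (rule convergent_approx)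
  interpret Metric_space X d by fact
  fix \<epsilon> :: real
  assume "\<epsilon> > 0"
  then obtain i where i: "\<forall>\<^sub>F n in sequentially. d (y n) (x i n) / r n \<le> \<epsilon>"
    using approx by blast
  have "\<bar>d (y n) (z n) / r n - d (x i n) (z n) / r n\<bar> \<le> d (y n) (x i n) / r n" for n
  proof -
    have "\<bar>d (y n) (z n) - d (x i n) (z n)\<bar> \<le> d (y n) (x i n)"
      using triangle[of "y n" "x i n" "z n"] triangle[of "x i n" "y n" "z n"]
        commute[of "x i n" "y n"] assms by auto
    moreover have "r n > 0"
      using assms by (simp add: scaling_sequence_def)
    ultimately show ?thesis
      by (simp flip: diff_divide_distrib add: abs_divide divide_right_mono)
  qed
  with i have "\<forall>\<^sub>F n in sequentially. \<bar>d (y n) (z n) / r n - d (x i n) (z n) / r n\<bar> \<le> \<epsilon>"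
    by (auto elim!: eventually_mono intro: order_trans)
  with conv show "\<exists>b. convergent b \<and>
      (\<forall>\<^sub>F n in sequentially. \<bar>d (y n) (z n) / r n - b n\<bar> \<le> \<epsilon>)"
    by blast
qed

lemma Metric_space_pretangent:
  assumes "Metric_space X d" "scaling_sequence r" "self_stable X d p r F"
  shows "Metric_space (pretangent_points d r F) (pretangent_dist d r F)"
proof -
  let ?P = "pretangent_points d r F" and ?\<rho> = "pretangent_dist d r F"
  note eq = equiv_stable_equiv[OF assms]
  have rep: "\<exists>x. x \<in> \<alpha> \<and> x \<in> F" if "\<alpha> \<in> ?P" for \<alpha>
    using that in_quotient_imp_non_empty[OF eq] in_quotient_imp_subset[OF eq]
    unfolding pretangent_points_def by blast
  note dist = pretangent_dist_eq[OF assms]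
  show ?thesis
  proof
    show "0 \<le> ?\<rho> \<alpha> \<beta>" for \<alpha> \<beta>
    proof (cases "\<alpha> \<in> ?P \<and> \<beta> \<in> ?P")
      case True
      with rep obtain x y where "x \<in> \<alpha>" "x \<in> F" "y \<in> \<beta>" "y \<in> F"
        by meson
      with True show ?thesis
        by (simp add: dist stable_dist_nonneg[OF assms])
    qed (auto simp: pretangent_dist_def)
    show "?\<rho> \<alpha> \<beta> = ?\<rho> \<beta> \<alpha>" for \<alpha> \<beta>
    proof (cases "\<alpha> \<in> ?P \<and> \<beta> \<in> ?P")
      case True
      with rep obtain x y where "x \<in> \<alpha>" "y \<in> \<beta>"
        by meson
      with True show ?thesis
        using stable_dist_commute[OF assms(1)] by (metis dist)
    qed (auto simp: pretangent_dist_def)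
    show "?\<rho> \<alpha> \<beta> = 0 \<longleftrightarrow> \<alpha> = \<beta>" if "\<alpha> \<in> ?P" "\<beta> \<in> ?P" for \<alpha> \<beta>
    proof -
      from that rep obtain x y where xy: "x \<in> \<alpha>" "x \<in> F" "y \<in> \<beta>" "y \<in> F"
        by meson
      \<comment> \<open>Separation is the axiom for which the pseudometric has to be passed to
        classes.\<close>
      have "\<alpha> = \<beta> \<longleftrightarrow> (x, y) \<in> stable_equiv d r F"
        using quotient_eq_iff[OF eq] that xy unfolding pretangent_points_def by blast
      with that xy show ?thesis
        by (simp add: dist[of \<alpha> x \<beta> y] stable_equiv_def)
    qed
    show "?\<rho> \<alpha> \<gamma> \<le> ?\<rho> \<alpha> \<beta> + ?\<rho> \<beta> \<gamma>" if "\<alpha> \<in> ?P" "\<beta> \<in> ?P" "\<gamma> \<in> ?P" for \<alpha> \<beta> \<gamma>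
    proof -
      from that rep obtain x y z
        where "x \<in> \<alpha>" "x \<in> F" "y \<in> \<beta>" "y \<in> F" "z \<in> \<gamma>" "z \<in> F"
        by meson
      with that show ?thesis
        by (simp add: dist stable_dist_triangle[OF assms])
    qed
  qed
qed

text \<open>Completeness before identification: the diagonal is built from representatives, so
  classes do not appear here.\<close>

lemma stable_dist_complete:
  assumes "Metric_space X d" "p \<in> X" "scaling_sequence r" "maximal_self_stable X d p r F"
    and xF: "\<And>i. x i \<in> F"
    and Cauchy: "\<And>\<epsilon>. \<epsilon> > 0 \<Longrightarrow> \<exists>N. \<forall>i\<ge>N. \<forall>j\<ge>N. stable_dist d r (x i) (x j) < \<epsilon>"
  obtains y where "y \<in> F" "(\<lambda>i. stable_dist d r y (x i)) \<longlonglongrightarrow> 0"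
proof -
  have ss: "self_stable X d p r F"
    using assms(4) by (simp add: maximal_self_stable_def)
  have Seq: "u \<in> Seq_infty X d p r" if "u \<in> F" for u
    using ss that by (auto simp: self_stable_def)
  have inX: "u n \<in> X" if "u \<in> F" for u n
    using Seq[OF that] by (simp add: Seq_infty_def)
  \<comment> \<open>The first clause will push the diagonal away from \<open>p\<close>; this does
    not follow from scaled distances, which may tend to 0. The second needs only upper bounds, with
    an error vanishing as k grows. For each k these are finitely many eventual conditions.\<close>
  define P where "P k n \<longleftrightarrow> (\<forall>i\<in>{..k}. real k \<le> d (x i n) p) \<and>
    (\<forall>i\<in>{..k}. \<forall>j\<in>{..k}. d (x i n) (x j n) / r n < stable_dist d r (x i) (x j) + 1 / Suc k)"
    for k n
  have "eventually (P k) sequentially" for k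
  proof -
    have "\<forall>\<^sub>F n in sequentially. real k \<le> d (x i n) p" for i
      using Seq[OF xF[of i]] by (simp add: Seq_infty_def filterlim_at_top)
    moreover have "\<forall>\<^sub>F n in sequentially.
        d (x i n) (x j n) / r n < stable_dist d r (x i) (x j) + 1 / Suc k" for i j
      by (rule order_tendstoD(2)[OF stable_dist_tendsto[OF ss xF xF]]) simp
    ultimately show ?thesis
      unfolding P_def by (intro eventually_conj eventually_ball_finite ballI) auto
  qed
  then obtain K where K: "filterlim K at_top sequentially" "\<forall>\<^sub>F n in sequentially. P (K n) n"
    by (rule slow_diagonal)
  define y where "y n = x (K n) n" for n
  have yX: "y n \<in> X" for n
    by (simp add: y_def inX xF)
  \<comment> \<open>\<open>N\<close> depends on \<epsilon> alone; the time from which the bound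
    holds may depend on i.\<close>
  have near: "\<exists>N. \<forall>i\<ge>N. \<forall>\<^sub>F n in sequentially. d (y n) (x i n) / r n \<le> \<epsilon>"
    if \<epsilon>: "\<epsilon> > 0" for \<epsilon>
  proof -
    obtain N where N: "\<And>i j. i \<ge> N \<Longrightarrow> j \<ge> N \<Longrightarrow> stable_dist d r (x i) (x j) < \<epsilon> / 2"
      using Cauchy[OF half_gt_zero[OF \<epsilon>]] by blast
    obtain M where M: "1 / real (Suc M) < \<epsilon> / 2"
      using nat_approx_posE[OF half_gt_zero[OF \<epsilon>]] by blast
    have "\<forall>\<^sub>F n in sequentially. d (y n) (x i n) / r n \<le> \<epsilon>" if "i \<ge> N" for i
    proof -
      \<comment> \<open>\<open>K n\<close> \<ge> i brings \<open>x i\<close> within the scope of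
        \<open>P (K n) n\<close> and gives \<open>K n\<close> \<ge> \<open>N\<close>;
        \<open>K n\<close> \<ge> \<open>M\<close> makes the error small.\<close>
      have "\<forall>\<^sub>F n in sequentially. max i M \<le> K n"
        using K(1) unfolding filterlim_at_top by blast
      then show ?thesis
        using K(2)
      proof eventually_elim
        case (elim n)
        then have "d (y n) (x i n) / r n < stable_dist d r (x (K n)) (x i) + 1 / Suc (K n)"
          by (simp add: P_def y_def)
        moreover have "stable_dist d r (x (K n)) (x i) < \<epsilon> / 2"
          using elim that by (intro N) auto
        moreover have "1 / real (Suc (K n)) \<le> 1 / real (Suc M)"
          using elim by (intro divide_left_mono) auto
        ultimately show ?case
          using M by linarith
      qed
    qed
    then show ?thesis
      by blast
  qed
  have conv: "convergent (\<lambda>n. d (y n) (z n) / r n)"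
    if "\<And>n. z n \<in> X" "\<And>i. convergent (\<lambda>n. d (x i n) (z n) / r n)" for z
    using near
    by (intro convergent_scaled_dist[where x = x, OF assms(1,3) inX[OF xF] yX that]) blast+
  have "filterlim (\<lambda>n. d (y n) p) at_top sequentially"
  proof (rule filterlim_at_top_mono)
    show "filterlim (\<lambda>n. real (K n)) at_top sequentially"
      by (rule filterlim_compose[OF filterlim_real_sequentially K(1)])
    show "\<forall>\<^sub>F n in sequentially. real (K n) \<le> d (y n) p"
      using K(2) by eventually_elim (simp add: P_def y_def)
  qed
  \<comment> \<open>Here \<open>z\<close> is constantly \<open>p\<close>, and the hypothesis on each
    \<open>x i\<close> is part of membership in \<open>Seq_infty\<close>.\<close>
  moreover have "convergent (\<lambda>n. d (y n) p / r n)"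
    using Seq[OF xF] by (intro conv) (auto simp: Seq_infty_def assms)
  ultimately have "y \<in> Seq_infty X d p r"
    by (simp add: Seq_infty_def yX)
  moreover have "mutually_stable d r u y" if "u \<in> F" for u
  proof -
    have "convergent (\<lambda>n. d (y n) (u n) / r n)"
      using ss xF that by (intro conv inX) (auto simp: self_stable_def mutually_stable_def)
    then show ?thesis
      by (simp add: mutually_stable_def Metric_space.commute[OF assms(1)])
  qed
  ultimately have yF: "y \<in> F"
    using assms(4) by (auto simp: maximal_self_stable_def)
  have "(\<lambda>i. stable_dist d r y (x i)) \<longlonglongrightarrow> 0"
  proof (rule LIMSEQ_I)
    fix e :: real
    assume "e > 0"
    then obtain N where N: "\<And>i. i \<ge> N \<Longrightarrow> \<forall>\<^sub>F n in sequentially. d (y n) (x i n) / r n \<le> e / 2"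
      using near[OF half_gt_zero[OF \<open>e > 0\<close>]] by blast
    \<comment> \<open>Membership of \<open>y\<close> in \<open>F\<close> makes the limit in n exist,
      so the eventual bound passes to it; e / 2 absorbs the loss of strictness.\<close>
    have "stable_dist d r y (x i) \<le> e / 2" if "i \<ge> N" for i
      using tendsto_upperbound[OF stable_dist_tendsto[OF ss yF xF] N[OF that]] by simp
    then show "\<exists>N. \<forall>i\<ge>N. norm (stable_dist d r y (x i) - 0) < e"
      using stable_dist_nonneg[OF assms(1,3) ss yF xF] \<open>e > 0\<close>
      by (intro exI[of _ N]) (fastforce simp: abs_of_nonneg)
  qed
  with yF show thesis
    by (rule that)
qed

theorem theorem3p3:
  fixes X :: "'a set" and d :: "'a \<Rightarrow> 'a \<Rightarrow> real" and p :: 'a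
    and r :: "nat \<Rightarrow> real" and F :: "(nat \<Rightarrow> 'a) set"
  assumes "unbounded_metric_space X d"
    and "p \<in> X"
    and "scaling_sequence r"
    and "maximal_self_stable X d p r F"
  shows "Metric_space (pretangent_points d r F) (pretangent_dist d r F)
       \<and> Metric_space.mcomplete (pretangent_points d r F) (pretangent_dist d r F)"
proof
  let ?P = "pretangent_points d r F" and ?\<rho> = "pretangent_dist d r F"
  have ms: "Metric_space X d"
    using assms(1) by (simp add: unbounded_metric_space_def)
  have ss: "self_stable X d p r F"
    using assms(4) by (simp add: maximal_self_stable_def)
  note eq = equiv_stable_equiv[OF ms assms(3) ss]
  note dist = pretangent_dist_eq[OF ms assms(3) ss]
  show "Metric_space ?P ?\<rho>"
    by (rule Metric_space_pretangent[OF ms assms(3) ss])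
  then interpret \<Omega>: Metric_space ?P ?\<rho> .
  show "\<Omega>.mcomplete"
    unfolding \<Omega>.mcomplete_def
  proof (intro allI impI)
    fix \<sigma>
    assume C: "\<Omega>.MCauchy \<sigma>"
    then have \<sigma>P: "\<sigma> i \<in> ?P" for i
      by (auto simp: \<Omega>.MCauchy_def)
    have "\<exists>u. u \<in> \<sigma> i \<and> u \<in> F" for i
      using \<sigma>P[of i] in_quotient_imp_non_empty[OF eq] in_quotient_imp_subset[OF eq]
      unfolding pretangent_points_def by blast
    then obtain x where x: "\<And>i. x i \<in> \<sigma> i" "\<And>i. x i \<in> F"
      by metis
    \<comment> \<open>Independence of representatives turns the Cauchy condition on classes into one
      on the chosen sequences.\<close>
    have "\<exists>N. \<forall>i\<ge>N. \<forall>j\<ge>N. stable_dist d r (x i) (x j) < \<epsilon>" if "\<epsilon> > 0" for \<epsilon>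
      using C that by (auto simp: \<Omega>.MCauchy_def dist[OF \<sigma>P x(1) \<sigma>P x(1)])
    then obtain y where y: "y \<in> F" "(\<lambda>i. stable_dist d r y (x i)) \<longlonglongrightarrow> 0"
      by (rule stable_dist_complete[where x = x, OF ms assms(2-4) x(2)])
    define \<alpha> where "\<alpha> = stable_equiv d r F `` {y}"
    have \<alpha>: "\<alpha> \<in> ?P" "y \<in> \<alpha>"
      using y(1) equiv_class_self[OF eq] by (auto simp: \<alpha>_def pretangent_points_def quotientI)
    have "(\<lambda>i. ?\<rho> (\<sigma> i) \<alpha>) \<longlonglongrightarrow> 0"
      using y(2) by (simp add: dist[OF \<sigma>P x(1) \<alpha>] stable_dist_commute[OF ms, of _ y])
    with \<alpha>(1) \<sigma>P show "\<exists>\<alpha>. limitin \<Omega>.mtopology \<sigma> \<alpha> sequentially"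
      by (auto simp: \<Omega>.limitin_metric_dist_null)
  qed
qed

end
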